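(* Let $\mu$ be a Borel probability measure on $\mathbb{R}^d$. Let $\omega_1$ and $\omega_2$ be two independent random vectors, both distributed with respect to $\mu$. Then $$ \mathbb{E}\,\Bigl|\sum_{j=1}^n c_j e^{-2\pi i\,x_j\cdot(\omega_1-\omega_2)}\Bigr|^2\ge \frac{1}{n}\Bigl|\sum_{j=1}^n c_j\Bigr|^2 $$ for every $n\ge 1$ and every choice of $c=(c_1,\dots,c_n)\in\mathbb{C}^n$ and $x_1,\dots,x_n\in\mathbb{R}^d$.
   Context: $x\cdot y$ denotes the Euclidean inner product on $\mathbb{R}^d$, $i$ is the imaginary unit, and $\mathbb{E}$ denotes expectation. *)

theory Defs
  imports "HOL-Probability.Probability"
begin

end

theory Submission
  imports Defs
begin

text \<open>
  Put \<open>e\<^sub>j(\<omega>) = exp (-2 \<pi> \<i> x\<^sub>j \<bullet> \<omega>)\<close>. The random variable in question is \<open>F(\<omega>\<^sub>1, \<omega>\<^sub>2)\<close> with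
  \<open>F(a, b) = \<Sum>\<^sub>j c\<^sub>j e\<^sub>j(a) cnj (e\<^sub>j(b))\<close>, so by independence its second moment is the
  squared Hilbert--Schmidt norm of the integral operator on \<open>L\<^sup>2(\<mu>)\<close> with kernel \<open>F\<close>. That operator
  has rank at most \<open>n\<close>, because its range lies in the span of the \<open>e\<^sub>j\<close>, and its trace is
  \<open>\<Sum>\<^sub>j c\<^sub>j \<parallel>e\<^sub>j\<parallel>\<^sup>2 = \<Sum>\<^sub>j c\<^sub>j\<close>. The inequality is therefore the familiar
  \<open>\<bar>trace\<bar>\<^sup>2 \<le> rank \<cdot> \<parallel>\<cdot>\<parallel>\<^sub>H\<^sub>S\<^sup>2\<close>.

  This is made concrete without operators. Gram--Schmidt (lemma \<open>orthonormal_spanning_family\<close>)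
  supplies orthonormal functions \<open>u\<^sub>k\<close>, at most \<open>n\<close> of them, for which Parseval's identity
  \<open>\<Sum>\<^sub>k \<bar>\<langle>e\<^sub>j, u\<^sub>k\<rangle>\<bar>\<^sup>2 = \<parallel>e\<^sub>j\<parallel>\<^sup>2\<close> holds. The diagonal entries of the operator in this system are
  \<open>s\<^sub>k = \<Sum>\<^sub>j c\<^sub>j \<bar>\<langle>e\<^sub>j, u\<^sub>k\<rangle>\<bar>\<^sup>2\<close>, whose sum is the trace. Bessel's inequality in \<open>a\<close>, then in
  \<open>b\<close>, gives \<open>\<Sum>\<^sub>k \<bar>s\<^sub>k\<bar>\<^sup>2 \<le> \<integral>\<integral> \<bar>F(a, b)\<bar>\<^sup>2\<close>, and the Cauchy--Schwarz inequality for
  the finite sum \<open>\<Sum>\<^sub>k s\<^sub>k\<close> finishes (lemma \<open>trace_sq_le_card_times_hilbert_schmidt\<close>).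
\<close>

section \<open>Square-integrable complex functions\<close>

text \<open>
  Functions are not identified when they agree almost everywhere, so \<open>ip\<close> is only positive
  semidefinite; all arguments below go through for such a form.
\<close>

definition sq_int :: "'a measure \<Rightarrow> ('a \<Rightarrow> complex) \<Rightarrow> bool" where
  "sq_int N f \<longleftrightarrow> f \<in> borel_measurable N \<and> integrable N (\<lambda>x. (cmod (f x))\<^sup>2)"

definition ip :: "'a measure \<Rightarrow> ('a \<Rightarrow> complex) \<Rightarrow> ('a \<Rightarrow> complex) \<Rightarrow> complex" where
  "ip N f g = (\<integral>x. f x * cnj (g x) \<partial>N)"

definition nrm2 :: "'a measure \<Rightarrow> ('a \<Rightarrow> complex) \<Rightarrow> real" where
  "nrm2 N f = (\<integral>x. (cmod (f x))\<^sup>2 \<partial>N)"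

lemma sq_int_integrable_prod:
  assumes "sq_int N f" "sq_int N g"
  shows "integrable N (\<lambda>x. f x * cnj (g x))"
proof (rule Bochner_Integration.integrable_bound)
  show "integrable N (\<lambda>x. (cmod (f x))\<^sup>2 + (cmod (g x))\<^sup>2)"
    using assms by (simp add: sq_int_def)
  have [measurable]: "f \<in> borel_measurable N" "g \<in> borel_measurable N"
    using assms by (simp_all add: sq_int_def)
  have "(\<lambda>x. cnj (g x)) \<in> borel_measurable N"
    by (rule borel_measurable_continuous_on[where g = g and f = cnj])
      (auto intro: continuous_intros)
  then show "(\<lambda>x. f x * cnj (g x)) \<in> borel_measurable N"
    by measurable
  have "a * b \<le> a\<^sup>2 + b\<^sup>2" if "a \<ge> 0" "b \<ge> 0" for a b :: real
    using sum_squares_bound[of a b] that mult_nonneg_nonneg[OF that] by linarith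
  then show "AE x in N. norm (f x * cnj (g x)) \<le> norm ((cmod (f x))\<^sup>2 + (cmod (g x))\<^sup>2)"
    by (simp add: norm_mult)
qed

lemma sq_int_cnj: "sq_int N f \<Longrightarrow> sq_int N (\<lambda>x. cnj (f x))"
  unfolding sq_int_def
  by (auto intro!: borel_measurable_continuous_on[where f = cnj] continuous_intros)

lemma sq_int_scale: "sq_int N f \<Longrightarrow> sq_int N (\<lambda>x. a * f x)"
  by (auto simp: sq_int_def norm_mult power_mult_distrib)

lemma sq_int_add:
  assumes "sq_int N f" "sq_int N g"
  shows "sq_int N (\<lambda>x. f x + g x)"
  unfolding sq_int_def
proof
  have [measurable]: "f \<in> borel_measurable N" "g \<in> borel_measurable N"
    using assms by (simp_all add: sq_int_def)
  show "(\<lambda>x. f x + g x) \<in> borel_measurable N"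
    by measurable
  show "integrable N (\<lambda>x. (cmod (f x + g x))\<^sup>2)"
  proof (rule Bochner_Integration.integrable_bound)
    show "integrable N (\<lambda>x. 2 * (cmod (f x))\<^sup>2 + 2 * (cmod (g x))\<^sup>2)"
      using assms by (simp add: sq_int_def)
    have "(cmod (a + b))\<^sup>2 \<le> 2 * (cmod a)\<^sup>2 + 2 * (cmod b)\<^sup>2" for a b
    proof -
      have "(cmod (a + b))\<^sup>2 \<le> (cmod a + cmod b)\<^sup>2"
        by (intro power_mono norm_triangle_ineq) simp
      also have "\<dots> \<le> 2 * (cmod a)\<^sup>2 + 2 * (cmod b)\<^sup>2"
        using sum_squares_bound[of "cmod a" "cmod b"] by (simp add: power2_sum)
      finally show ?thesis .
    qed
    then show "AE x in N. norm ((cmod (f x + g x))\<^sup>2)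
        \<le> norm (2 * (cmod (f x))\<^sup>2 + 2 * (cmod (g x))\<^sup>2)"
      by simp
  qed measurable
qed

lemma sq_int_sum:
  "(\<And>k. k \<in> K \<Longrightarrow> sq_int N (f k)) \<Longrightarrow> sq_int N (\<lambda>x. \<Sum>k\<in>K. f k x)"
proof (induction K rule: infinite_finite_induct)
  case (insert k K)
  then show ?case by (simp add: sq_int_add)
qed (simp_all add: sq_int_def)

lemma sq_int_diff: "sq_int N f \<Longrightarrow> sq_int N g \<Longrightarrow> sq_int N (\<lambda>x. f x - g x)"
  using sq_int_add[of N f "\<lambda>x. (-1) * g x"] sq_int_scale[of N g "-1"] by simp

lemma ip_diff_left:
  assumes "sq_int N f" "sq_int N g" "sq_int N h"
  shows "ip N (\<lambda>x. f x - g x) h = ip N f h - ip N g h"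
  using assms by (simp add: ip_def left_diff_distrib sq_int_integrable_prod)

lemma ip_scale_left: "ip N (\<lambda>x. a * f x) h = a * ip N f h"
  by (simp add: ip_def mult.assoc)

lemma ip_sum_left:
  assumes "\<And>k. k \<in> K \<Longrightarrow> sq_int N (f k)" "sq_int N h"
  shows "ip N (\<lambda>x. \<Sum>k\<in>K. f k x) h = (\<Sum>k\<in>K. ip N (f k) h)"
  using assms by (simp add: ip_def sum_distrib_right sq_int_integrable_prod)

lemma ip_cnj_cnj: "ip N (\<lambda>x. cnj (f x)) (\<lambda>x. cnj (g x)) = cnj (ip N f g)"
  unfolding ip_def by (subst Bochner_Integration.integral_cnj[symmetric]) simp

lemma ip_commute: "ip N g f = cnj (ip N f g)"
  unfolding ip_def by (subst Bochner_Integration.integral_cnj[symmetric]) (simp add: mult.commute)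

lemma ip_self: "ip N f f = of_real (nrm2 N f)"
  by (simp add: ip_def nrm2_def complex_norm_square[symmetric] flip: integral_complex_of_real)

lemma nrm2_nonneg: "nrm2 N f \<ge> 0"
  by (simp add: nrm2_def)

section \<open>Bessel's inequality and Gram--Schmidt\<close>

definition orthonormal :: "'a measure \<Rightarrow> nat \<Rightarrow> (nat \<Rightarrow> 'a \<Rightarrow> complex) \<Rightarrow> bool" where
  "orthonormal N r u \<longleftrightarrow> (\<forall>k<r. sq_int N (u k)) \<and>
     (\<forall>j<r. \<forall>k<r. ip N (u j) (u k) = (if j = k then 1 else 0))"

definition residual ::
    "'a measure \<Rightarrow> nat \<Rightarrow> (nat \<Rightarrow> 'a \<Rightarrow> complex) \<Rightarrow> ('a \<Rightarrow> complex) \<Rightarrow> 'a \<Rightarrow> complex" where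
  "residual N r u f = (\<lambda>x. f x - (\<Sum>k<r. ip N f (u k) * u k x))"

lemma sq_int_residual:
  "orthonormal N r u \<Longrightarrow> sq_int N f \<Longrightarrow> sq_int N (residual N r u f)"
  unfolding residual_def orthonormal_def
  by (intro sq_int_diff sq_int_sum sq_int_scale) auto

lemma ip_residual_left:
  assumes "orthonormal N r u" "sq_int N f" "sq_int N h"
  shows "ip N (residual N r u f) h = ip N f h - (\<Sum>k<r. ip N f (u k) * ip N (u k) h)"
proof -
  have u: "sq_int N (u k)" if "k < r" for k
    using assms(1) that by (simp add: orthonormal_def)
  have "ip N (residual N r u f) h
      = ip N f h - ip N (\<lambda>x. \<Sum>k<r. ip N f (u k) * u k x) h"
    unfolding residual_def
    by (intro ip_diff_left assms sq_int_sum sq_int_scale u) simp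
  also have "ip N (\<lambda>x. \<Sum>k<r. ip N f (u k) * u k x) h
      = (\<Sum>k<r. ip N (\<lambda>x. ip N f (u k) * u k x) h)"
    by (intro ip_sum_left assms sq_int_scale u) simp
  finally show ?thesis
    by (simp add: ip_scale_left)
qed

lemma residual_orthogonal:
  assumes "orthonormal N r u" "sq_int N f" "j < r"
  shows "ip N (residual N r u f) (u j) = 0"
proof -
  have "sq_int N (u j)"
    using assms by (simp add: orthonormal_def)
  then have "ip N (residual N r u f) (u j)
      = ip N f (u j) - (\<Sum>k<r. ip N f (u k) * ip N (u k) (u j))"
    by (intro ip_residual_left assms)
  also have "(\<Sum>k<r. ip N f (u k) * ip N (u k) (u j))
      = (\<Sum>k<r. if k = j then ip N f (u k) else 0)"
    using assms by (intro sum.cong) (auto simp: orthonormal_def)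
  finally show ?thesis
    using assms by simp
qed

lemma ip_residual_self:
  assumes "orthonormal N r u" "sq_int N f"
  shows "ip N (residual N r u f) f = of_real (nrm2 N f - (\<Sum>k<r. (cmod (ip N f (u k)))\<^sup>2))"
proof -
  have "ip N f (u k) * ip N (u k) f = of_real ((cmod (ip N f (u k)))\<^sup>2)" for k
    by (subst ip_commute[of N "u k" f]) (simp only: complex_norm_square)
  then show ?thesis
    by (simp add: ip_residual_left[OF assms assms(2)] ip_self)
qed

lemma pythagoras:
  assumes "orthonormal N r u" "sq_int N f"
  shows "nrm2 N (residual N r u f) = nrm2 N f - (\<Sum>k<r. (cmod (ip N f (u k)))\<^sup>2)"
proof -
  let ?g = "residual N r u f"
  note g = sq_int_residual[OF assms]
  have "ip N (u k) ?g = 0" if "k < r" for k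
    by (subst ip_commute) (simp add: residual_orthogonal[OF assms that])
  then have "ip N ?g ?g = ip N f ?g"
    using ip_residual_left[OF assms g] by simp
  also have "\<dots> = of_real (nrm2 N f - (\<Sum>k<r. (cmod (ip N f (u k)))\<^sup>2))"
    by (subst ip_commute) (simp only: ip_residual_self[OF assms] complex_cnj_complex_of_real)
  finally show ?thesis
    by (simp only: ip_self of_real_eq_iff)
qed

lemma bessel:
  assumes "orthonormal N r u" "sq_int N f"
  shows "(\<Sum>k<r. (cmod (ip N f (u k)))\<^sup>2) \<le> nrm2 N f"
  using pythagoras[OF assms] nrm2_nonneg[of N "residual N r u f"] by simp

lemma bessel_single:
  assumes "sq_int N f" "sq_int N v" "nrm2 N v = 1"
  shows "(cmod (ip N f v))\<^sup>2 \<le> nrm2 N f"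
  using bessel[of N 1 "\<lambda>_. v" f] assms by (simp add: orthonormal_def ip_self)

lemma orthonormal_append:
  assumes u: "orthonormal N r u" and v: "sq_int N v" "nrm2 N v = 1"
    and orth: "\<And>k. k < r \<Longrightarrow> ip N v (u k) = 0"
  shows "orthonormal N (Suc r) (u(r := v))"
proof -
  have "ip N (u k) v = 0" if "k < r" for k
    by (subst ip_commute) (simp add: orth[OF that])
  then show ?thesis
    using u v orth by (auto simp: orthonormal_def less_Suc_eq ip_self)
qed

text \<open>
  Gram--Schmidt. That the \<open>f j\<close> lie in the span of the \<open>u k\<close> up to null sets is expressed by
  Parseval's identity. In this form it is preserved for free when a further function is appended
  to \<open>u\<close>: the sum of squares can only grow, and Bessel's inequality bounds it by the norm.
\<close>

lemma orthonormal_spanning_family: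
  assumes "finite J" "\<And>j. j \<in> J \<Longrightarrow> sq_int N (f j)"
  shows "\<exists>r u. r \<le> card J \<and> orthonormal N r u \<and>
    (\<forall>j\<in>J. (\<Sum>k<r. (cmod (ip N (f j) (u k)))\<^sup>2) = nrm2 N (f j))"
  using assms
proof (induction J rule: finite_induct)
  case empty
  show ?case by (auto simp: orthonormal_def)
next
  case (insert i J)
  then obtain r u where r: "r \<le> card J" and u: "orthonormal N r u"
    and parseval: "\<And>j. j \<in> J \<Longrightarrow> (\<Sum>k<r. (cmod (ip N (f j) (u k)))\<^sup>2) = nrm2 N (f j)"
    by (metis insertCI)
  have fi: "sq_int N (f i)"
    using insert.prems by simp
  define g where "g = residual N r u (f i)"
  have g: "sq_int N g"
    unfolding g_def by (rule sq_int_residual[OF u fi])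
  have nrm_g: "nrm2 N g = nrm2 N (f i) - (\<Sum>k<r. (cmod (ip N (f i) (u k)))\<^sup>2)"
    unfolding g_def by (rule pythagoras[OF u fi])
  \<comment> \<open>A null residual means that \<open>f i\<close> already satisfies Parseval's identity; otherwise its
    normalisation is the new member of the family.\<close>
  show ?case
  proof (cases "nrm2 N g = 0")
    case True
    then have "(\<Sum>k<r. (cmod (ip N (f i) (u k)))\<^sup>2) = nrm2 N (f i)"
      using nrm_g by simp
    then show ?thesis
      using r u parseval insert.hyps
      by (intro exI[of _ r] exI[of _ u]) auto
  next
    case False
    then have pos: "nrm2 N g > 0"
      using nrm2_nonneg[of N g] by simp
    define t where "t = 1 / sqrt (nrm2 N g)"
    have t: "t\<^sup>2 * nrm2 N g = 1"
      using pos by (simp add: t_def power_divide)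
    define v where "v = (\<lambda>x. of_real t * g x)"
    define u' where "u' = u(r := v)"
    have v: "sq_int N v"
      unfolding v_def by (rule sq_int_scale[OF g])
    have "nrm2 N v = 1"
      using t by (simp add: v_def nrm2_def norm_mult power_mult_distrib)
    moreover have "ip N v (u k) = 0" if "k < r" for k
      using residual_orthogonal[OF u fi that] by (simp add: v_def ip_scale_left g_def)
    ultimately have u': "orthonormal N (Suc r) u'"
      unfolding u'_def by (intro orthonormal_append u v)
    have split: "(\<Sum>k<Suc r. (cmod (ip N h (u' k)))\<^sup>2)
        = (\<Sum>k<r. (cmod (ip N h (u k)))\<^sup>2) + (cmod (ip N h v))\<^sup>2" for h
      by (simp add: u'_def)
    have "(\<Sum>k<Suc r. (cmod (ip N (f j) (u' k)))\<^sup>2) = nrm2 N (f j)" if "j \<in> J" for j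
    proof (rule antisym)
      show "(\<Sum>k<Suc r. (cmod (ip N (f j) (u' k)))\<^sup>2) \<le> nrm2 N (f j)"
        using insert.prems that by (intro bessel[OF u']) simp
      show "nrm2 N (f j) \<le> (\<Sum>k<Suc r. (cmod (ip N (f j) (u' k)))\<^sup>2)"
        unfolding split parseval[OF that] by simp
    qed
    moreover have "(\<Sum>k<Suc r. (cmod (ip N (f i) (u' k)))\<^sup>2) = nrm2 N (f i)"
    proof -
      have "ip N g (f i) = of_real (nrm2 N g)"
        using ip_residual_self[OF u fi] nrm_g by (simp only: g_def)
      then have "ip N v (f i) = of_real (t * nrm2 N g)"
        by (simp add: v_def ip_scale_left)
      then have "ip N (f i) v = of_real (t * nrm2 N g)"
        by (subst ip_commute) simp
      then have "(cmod (ip N (f i) v))\<^sup>2 = (t * nrm2 N g)\<^sup>2"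
        by (simp only: norm_of_real power2_abs)
      also have "\<dots> = nrm2 N g"
        using t by (simp add: power2_eq_square mult.assoc mult.left_commute)
      finally show ?thesis
        unfolding split using nrm_g by simp
    qed
    ultimately show ?thesis
      using r u' insert.hyps by (intro exI[of _ "Suc r"] exI[of _ u']) auto
  qed
qed

section \<open>The trace of a finite-rank kernel\<close>

lemma cmod_sum_sq_le:
  fixes s :: "nat \<Rightarrow> complex"
  shows "(cmod (\<Sum>k<r. s k))\<^sup>2 \<le> real r * (\<Sum>k<r. (cmod (s k))\<^sup>2)"
proof -
  have "(cmod (\<Sum>k<r. s k))\<^sup>2 \<le> (\<Sum>k<r. cmod (s k))\<^sup>2"
    by (intro power_mono norm_sum) simp
  also have "\<dots> \<le> real r * (\<Sum>k<r. (cmod (s k))\<^sup>2)"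
    using Cauchy_Schwarz_ineq_sum[of "\<lambda>_. 1" "\<lambda>k. cmod (s k)" "{..<r}"] by simp
  finally show ?thesis .
qed

text \<open>
  With \<open>F b\<close> the slice of the kernel at fixed second argument and \<open>h k b = \<langle>F b, u\<^sub>k\<rangle>\<close>, the
  number \<open>s k = \<langle>h k, cnj u\<^sub>k\<rangle>\<close> is the coefficient of the kernel at \<open>u\<^sub>k(a) cnj (u\<^sub>k(b))\<close>. Taking
  the coefficients one variable at a time needs only Bessel's inequality on \<open>N\<close> itself, never an
  inner product on the product space.
\<close>

lemma trace_sq_le_card_times_hilbert_schmidt:
  fixes e :: "'i \<Rightarrow> 'a \<Rightarrow> complex" and c :: "'i \<Rightarrow> complex"
  assumes J: "finite J" and e: "\<And>j. j \<in> J \<Longrightarrow> sq_int N (e j)"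
  shows "(cmod (\<Sum>j\<in>J. c j * of_real (nrm2 N (e j))))\<^sup>2
    \<le> real (card J) * (\<integral>b. (\<integral>a. (cmod (\<Sum>j\<in>J. c j * e j a * cnj (e j b)))\<^sup>2 \<partial>N) \<partial>N)"
proof -
  obtain r u where r: "r \<le> card J" and u: "orthonormal N r u"
    and parseval: "\<And>j. j \<in> J \<Longrightarrow> (\<Sum>k<r. (cmod (ip N (e j) (u k)))\<^sup>2) = nrm2 N (e j)"
    using orthonormal_spanning_family[where f = e, OF J e] by blast
  have uk: "sq_int N (u k)" "ip N (u k) (u k) = 1" if "k < r" for k
    using u that by (auto simp: orthonormal_def)
  define F where "F = (\<lambda>b a. \<Sum>j\<in>J. (c j * cnj (e j b)) * e j a)"
  define h where "h = (\<lambda>k b. \<Sum>j\<in>J. (c j * ip N (e j) (u k)) * cnj (e j b))"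
  define s where "s = (\<lambda>k. \<Sum>j\<in>J. c j * of_real ((cmod (ip N (e j) (u k)))\<^sup>2))"
  have F: "sq_int N (F b)" for b
    unfolding F_def by (intro sq_int_sum sq_int_scale e)
  have h: "sq_int N (h k)" for k
    unfolding h_def by (intro sq_int_sum sq_int_scale sq_int_cnj e)

  have ip_F: "ip N (F b) g = (\<Sum>j\<in>J. c j * cnj (e j b) * ip N (e j) g)" if "sq_int N g" for b g
    unfolding F_def by (subst ip_sum_left) (auto intro: sq_int_scale e that simp: ip_scale_left)
  have F_bessel: "(\<Sum>k<r. (cmod (h k b))\<^sup>2) \<le> nrm2 N (F b)" for b
  proof -
    have "h k b = ip N (F b) (u k)" if "k < r" for k
      unfolding ip_F[OF uk(1)[OF that]] by (simp add: h_def mult_ac)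
    then show ?thesis
      using bessel[OF u F[of b]] by simp
  qed

  have h_bessel: "(cmod (s k))\<^sup>2 \<le> nrm2 N (h k)" if "k < r" for k
  proof -
    have "ip N (h k) (\<lambda>x. cnj (u k x))
        = (\<Sum>j\<in>J. c j * ip N (e j) (u k) * cnj (ip N (e j) (u k)))"
      unfolding h_def
      by (subst ip_sum_left, intro sq_int_scale sq_int_cnj e, assumption,
          intro sq_int_cnj uk(1)[OF that], simp only: ip_scale_left ip_cnj_cnj)
    also have "\<dots> = s k"
      unfolding s_def by (simp only: complex_norm_square mult.assoc)
    finally have "ip N (h k) (\<lambda>x. cnj (u k x)) = s k" .
    moreover have "nrm2 N (\<lambda>x. cnj (u k x)) = 1"
      using uk(2)[OF that] by (simp add: ip_self) (simp add: nrm2_def)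
    ultimately show ?thesis
      using bessel_single[OF h[of k] sq_int_cnj[OF uk(1)[OF that]]] by simp
  qed

  have F_int: "integrable N (\<lambda>b. nrm2 N (F b))"
  proof -
    \<comment> \<open>The squared norm of a slice is a Hermitian form in the values \<open>e j b\<close>, hence a finite
      combination of products of two square-integrable functions of \<open>b\<close>.\<close>
    have "of_real (nrm2 N (F b))
        = (\<Sum>i\<in>J. \<Sum>j\<in>J. (c i * cnj (c j) * ip N (e i) (e j)) * (e j b * cnj (e i b)))" for b
    proof -
      have "ip N (e i) (F b) = (\<Sum>j\<in>J. cnj (c j) * e j b * ip N (e i) (e j))" if "i \<in> J" for i
        by (subst ip_commute) (simp add: ip_F[OF e[OF that]] ip_commute[of N "e i", symmetric])
      then show ?thesis
        unfolding ip_self[symmetric] ip_F[OF F]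
        by (simp add: sum_distrib_left mult_ac)
    qed
    then have "integrable N (\<lambda>b. complex_of_real (nrm2 N (F b)))"
      by (simp only:) (intro Bochner_Integration.integrable_sum integrable_mult_right
          sq_int_integrable_prod e)
    then show ?thesis
      by (simp add: complex_of_real_integrable_eq)
  qed
  have h_int: "integrable N (\<lambda>b. (cmod (h k b))\<^sup>2)" for k
    using h by (simp add: sq_int_def)

  have "(\<Sum>k<r. (cmod (s k))\<^sup>2) \<le> (\<Sum>k<r. nrm2 N (h k))"
    by (intro sum_mono h_bessel) simp
  also have "\<dots> = (\<integral>b. (\<Sum>k<r. (cmod (h k b))\<^sup>2) \<partial>N)"
    by (simp add: nrm2_def h_int)
  also have "\<dots> \<le> (\<integral>b. nrm2 N (F b) \<partial>N)"
    by (intro integral_mono F_bessel F_int Bochner_Integration.integrable_sum h_int)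
  finally have coefficients: "(\<Sum>k<r. (cmod (s k))\<^sup>2) \<le> (\<integral>b. nrm2 N (F b) \<partial>N)" .

  have "(\<Sum>j\<in>J. c j * of_real (nrm2 N (e j))) = (\<Sum>k<r. s k)"
    unfolding s_def
    by (subst sum.swap) (simp add: parseval[symmetric] sum_distrib_left)
  then have "(cmod (\<Sum>j\<in>J. c j * of_real (nrm2 N (e j))))\<^sup>2 \<le> real r * (\<Sum>k<r. (cmod (s k))\<^sup>2)"
    using cmod_sum_sq_le by simp
  also have "\<dots> \<le> real (card J) * (\<integral>b. nrm2 N (F b) \<partial>N)"
    using r coefficients by (intro mult_mono sum_nonneg) auto
  also have "(\<integral>b. nrm2 N (F b) \<partial>N)
      = (\<integral>b. (\<integral>a. (cmod (\<Sum>j\<in>J. c j * e j a * cnj (e j b)))\<^sup>2 \<partial>N) \<partial>N)"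
    by (simp add: nrm2_def F_def mult_ac)
  finally show ?thesis .
qed

section \<open>Random characters\<close>

theorem theorem7:
  fixes \<mu> :: "(real ^ 'd) measure"
    and M :: "'w measure"
    and \<omega>1 \<omega>2 :: "'w \<Rightarrow> real ^ 'd"
    and n :: nat
    and c :: "nat \<Rightarrow> complex"
    and x :: "nat \<Rightarrow> real ^ 'd"
  assumes "prob_space \<mu>" and "sets \<mu> = sets borel"
    and "prob_space M"
    and "prob_space.indep_var M borel \<omega>1 borel \<omega>2"
    and "distr M borel \<omega>1 = \<mu>" and "distr M borel \<omega>2 = \<mu>"
    and "n \<ge> 1"
  shows "prob_space.expectation M
           (\<lambda>w. (cmod (\<Sum>j=1..n. c j *
              exp (- 2 * of_real pi * \<i> * of_real (x j \<bullet> (\<omega>1 w - \<omega>2 w)))))\<^sup>2)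
         \<ge> 1 / real n * (cmod (\<Sum>j=1..n. c j))\<^sup>2"
proof -
  interpret M: prob_space M by fact
  interpret \<mu>: prob_space \<mu> by fact
  interpret P: pair_prob_space \<mu> \<mu> ..
  have rv: "\<omega>1 \<in> measurable M borel" "\<omega>2 \<in> measurable M borel"
    and joint: "distr M (borel \<Otimes>\<^sub>M borel) (\<lambda>w. (\<omega>1 w, \<omega>2 w)) = \<mu> \<Otimes>\<^sub>M \<mu>"
    using assms(4-6) by (auto simp: M.indep_var_distribution_eq)
  define e where "e = (\<lambda>j a. exp (- 2 * of_real pi * \<i> * of_real (x j \<bullet> a)))"
  have cmod_e: "cmod (e j a) = 1" for j a
    by (simp add: e_def)
  have e_diff: "exp (- 2 * of_real pi * \<i> * of_real (x j \<bullet> (a - b))) = e j a * cnj (e j b)"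
    for j a b
    unfolding e_def exp_cnj exp_add[symmetric]
    by (simp add: inner_diff_right algebra_simps)
  have [measurable]: "e j \<in> borel_measurable borel" for j
    unfolding e_def by (intro borel_measurable_continuous_onI continuous_intros)
  have "e j \<in> borel_measurable \<mu>" for j
    by (simp add: measurable_cong_sets[OF assms(2) refl])
  then have e: "sq_int \<mu> (e j)" for j
    by (simp add: sq_int_def cmod_e)
  have nrm_e: "nrm2 \<mu> (e j) = 1" for j
    by (simp add: nrm2_def cmod_e \<mu>.prob_space)
  \<comment> \<open>Independence turns the expectation into an integral over the product measure \<open>\<mu> \<Otimes>\<^sub>M \<mu>\<close>, and
    boundedness of the characters lets Fubini's theorem make it an iterated integral.\<close>
  define G where "G = (\<lambda>a b. (cmod (\<Sum>j=1..n. c j * e j a * cnj (e j b)))\<^sup>2)"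
  have [measurable]: "(\<lambda>b. cnj (e j b)) \<in> borel_measurable borel" for j
    by (rule borel_measurable_continuous_on[where f = cnj]) (auto intro: continuous_intros)
  have G_meas: "case_prod G \<in> borel_measurable (borel \<Otimes>\<^sub>M borel)"
    unfolding G_def by measurable
  have G_int: "integrable (\<mu> \<Otimes>\<^sub>M \<mu>) (case_prod G)"
  proof (rule P.P.integrable_const_bound)
    have "cmod (\<Sum>j=1..n. c j * e j a * cnj (e j b)) \<le> (\<Sum>j=1..n. cmod (c j))" for a b
      by (rule order_trans[OF norm_sum]) (simp add: norm_mult cmod_e)
    then have "norm (G a b) \<le> (\<Sum>j=1..n. cmod (c j))\<^sup>2" for a b
      unfolding G_def real_norm_def power_abs abs_norm_cancel by (intro power_mono norm_ge_zero)
    then show "AE p in \<mu> \<Otimes>\<^sub>M \<mu>. norm (case_prod G p) \<le> (\<Sum>j=1..n. cmod (c j))\<^sup>2"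
      by (intro always_eventually) (simp add: split_beta)
    show "case_prod G \<in> borel_measurable (\<mu> \<Otimes>\<^sub>M \<mu>)"
      using G_meas assms(2) by (simp cong: measurable_cong_sets sets_pair_measure_cong)
  qed
  have "M.expectation (\<lambda>w. (cmod (\<Sum>j=1..n. c j *
          exp (- 2 * of_real pi * \<i> * of_real (x j \<bullet> (\<omega>1 w - \<omega>2 w)))))\<^sup>2)
      = M.expectation (\<lambda>w. case_prod G (\<omega>1 w, \<omega>2 w))"
    unfolding e_diff G_def by (simp add: mult.assoc)
  also have "\<dots> = (\<integral>p. case_prod G p \<partial>(\<mu> \<Otimes>\<^sub>M \<mu>))"
    unfolding joint[symmetric]
    by (rule integral_distr[symmetric]) (use rv G_meas in measurable)
  also have "\<dots> = (\<integral>b. (\<integral>a. G a b \<partial>\<mu>) \<partial>\<mu>)"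
    by (rule P.integral_snd[OF G_int, symmetric])
  finally have "(cmod (\<Sum>j=1..n. c j))\<^sup>2 \<le> real n * M.expectation (\<lambda>w. (cmod (\<Sum>j=1..n. c j *
          exp (- 2 * of_real pi * \<i> * of_real (x j \<bullet> (\<omega>1 w - \<omega>2 w)))))\<^sup>2)"
    using trace_sq_le_card_times_hilbert_schmidt[of "{1..n}" \<mu> e c] e
    by (simp add: G_def nrm_e)
  then show ?thesis
    using assms(7) by (simp add: field_simps)
qed

end
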